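(* Let $\mathcal L$ be a $4$-dimensional naturally graded $2$-filiform non-split complex Leibniz algebra of type $\mu_{(I,1,2)}$. Then $\mathcal L$ is isomorphic to the algebra with basis $\{e_1,e_2,e_3,e_4\}$ and products $$[e_1,e_1]=e_2,\qquad [e_1,e_3]=e_4,$$ all other products of basis elements being zero.
   Context: All algebras are finite-dimensional over $\mathbb C$. A Leibniz algebra is a vector space with a bilinear bracket satisfying $[x,[y,z]]=[[x,y],z]-[[x,z],y]$. Put $\mathcal L^1=\mathcal L$, $\mathcal L^{k+1}=[\mathcal L^k,\mathcal L]$; $\mathcal L$ is nilpotent if $\mathcal L^k=0$ for some $k$. It is non-split if it is not a direct sum of two nonzero ideals. For $x\in\mathcal L$ let $R_x(z)=[z,x]$. For nilpotent $\mathcal L$ and $x\in\mathcal L\setminus[\mathcal L,\mathcal L]$ let $C(x)$ be the decreasing sequence of sizes of the Jordan blocks of the nilpotent operator $R_x$; the characteristic sequence is $C(\mathcal L)=\max_{x\in\mathcal L\setminus[\mathcal L,\mathcal L]}C(x)$ in the lexicographic order. An $n$-dimensional nilpotent Leibniz algebra is $2$-filiform if $C(\mathcal L)=(n-2,1,1)$. Natural gradation: $\mathcal L_i=\mathcal L^i/\mathcal L^{i+1}$, $i\geq1$, with the induced bracket $[\mathcal L_i,\mathcal L_j]\subseteq\mathcal L_{i+j}$. $\mathcal L$ is naturally graded if $\mathcal L\cong\bigoplus_i\mathcal L_i$ as algebras; one then identifies $\mathcal L$ with $\bigoplus_i\mathcal L_i$. A naturally graded $n$-dimensional $2$-filiform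 algebra is of type $\mu_{(I,r_1,r_2)}$ (with $r_1\le r_2$) if it has a basis $\{e_1,\dots,e_n\}$ (adapted basis) of homogeneous elements with $e_1\in\mathcal L_1$, $C(e_1)=(n-2,1,1)$, $[e_i,e_1]=e_{i+1}$ for $1\le i\le n-3$, $[e_{n-2},e_1]=[e_{n-1},e_1]=[e_n,e_1]=0$ (so $e_i\in\mathcal L_i$ for $1\le i\le n-2$), and $e_{n-1}\in\mathcal L_{r_1}$, $e_n\in\mathcal L_{r_2}$. *)

theory Defs
  imports
    "HOL-Library.Product_Plus"
    "Jordan_Normal_Form.Jordan_Normal_Form"
begin

text \<open>The type variable is the underlying set of the algebra; \<open>scale\<close> and \<open>bracket\<close> are
  parameters, so that one type can carry different algebras.\<close>

locale leibniz_algebra = vector_space scale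
  for scale :: "complex \<Rightarrow> 'a::ab_group_add \<Rightarrow> 'a" +
  fixes bracket :: "'a \<Rightarrow> 'a \<Rightarrow> 'a"
  assumes finite_dimensional: "\<exists>B. finite B \<and> span B = UNIV"
    and linear_left: "Vector_Spaces.linear scale scale (\<lambda>x. bracket x y)"
    and linear_right: "Vector_Spaces.linear scale scale (\<lambda>y. bracket x y)"
    and leibniz: "bracket x (bracket y z) = bracket (bracket x y) z - bracket (bracket x z) y"
begin

text \<open>The lower central series, with \<open>lcs k\<close> for \<open>\<L>\<^sup>k\<close> and \<open>k \<ge> 1\<close>. The additional value
  \<open>lcs 0 = \<L>\<close> makes the quotient \<open>lcs 0 / lcs 1\<close> zero, so that the gradation below can be
  indexed by all natural numbers without acquiring a component of degree 0.\<close>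

fun lcs :: "nat \<Rightarrow> 'a set" where
  "lcs 0 = UNIV"
| "lcs (Suc 0) = UNIV"
| "lcs (Suc (Suc k)) = span {bracket x y |x y. x \<in> lcs (Suc k)}"

definition nilpotent :: bool where
  "nilpotent \<longleftrightarrow> (\<exists>k\<ge>1. lcs k = {0})"

definition ideal :: "'a set \<Rightarrow> bool" where
  "ideal I \<longleftrightarrow> subspace I \<and> (\<forall>x\<in>I. \<forall>y. bracket x y \<in> I \<and> bracket y x \<in> I)"

definition non_split :: bool where
  "non_split \<longleftrightarrow>
    \<not> (\<exists>I J. ideal I \<and> ideal J \<and> I \<noteq> {0} \<and> J \<noteq> {0} \<and>
         I \<inter> J = {0} \<and> {x + y |x y. x \<in> I \<and> y \<in> J} = UNIV)"

definition right_mult :: "'a \<Rightarrow> 'a \<Rightarrow> 'a" where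
  "right_mult x z = bracket z x"

definition ordered_basis :: "(nat \<Rightarrow> 'a) \<Rightarrow> nat set \<Rightarrow> bool" where
  "ordered_basis b N \<longleftrightarrow> inj_on b N \<and> independent (b ` N) \<and> span (b ` N) = UNIV"

definition matrix_of :: "(nat \<Rightarrow> 'a) \<Rightarrow> ('a \<Rightarrow> 'a) \<Rightarrow> complex mat" where
  "matrix_of b T =
    mat (dim (UNIV :: 'a set)) (dim (UNIV :: 'a set))
      (\<lambda>(i, j). representation (b ` {..<dim (UNIV :: 'a set)}) (T (b j)) (b i))"

text \<open>\<open>jordan_sizes T s\<close>: \<open>s\<close> is the decreasing list of the sizes of the Jordan blocks of \<open>T\<close>.
  The Jordan normal form exists and is unique up to the order of the blocks, so every linear \<open>T\<close>
  has exactly one such \<open>s\<close>.\<close>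

definition jordan_sizes :: "('a \<Rightarrow> 'a) \<Rightarrow> nat list \<Rightarrow> bool" where
  "jordan_sizes T s \<longleftrightarrow>
    (\<exists>b n_as. ordered_basis b {..<dim (UNIV :: 'a set)} \<and> jordan_nf (matrix_of b T) n_as \<and>
       s = rev (sort (map fst n_as)))"

text \<open>\<open>characteristic_sequence s\<close>: \<open>s\<close> is the lexicographic maximum of \<open>C(x)\<close> over
  \<open>x \<in> \<L> - [\<L>, \<L>]\<close>.\<close>

definition characteristic_sequence :: "nat list \<Rightarrow> bool" where
  "characteristic_sequence s \<longleftrightarrow>
    (\<exists>x. x \<notin> lcs 2 \<and> jordan_sizes (right_mult x) s) \<and>
    (\<forall>x t. x \<notin> lcs 2 \<and> jordan_sizes (right_mult x) t \<longrightarrow> lexordp_eq t s)"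

definition two_filiform :: bool where
  "two_filiform \<longleftrightarrow>
    nilpotent \<and> characteristic_sequence [dim (UNIV :: 'a set) - 2, 1, 1]"

text \<open>The associated graded algebra. Its elements are the finitely supported families \<open>f\<close> whose
  entry \<open>f i\<close> is an element of \<open>lcs i / lcs (i + 1)\<close>, that is, a coset.\<close>

definition coset :: "nat \<Rightarrow> 'a \<Rightarrow> 'a set" where
  "coset i x = {x + u |u. u \<in> lcs (Suc i)}"

definition gr_carrier :: "(nat \<Rightarrow> 'a set) set" where
  "gr_carrier = {f. (\<forall>i. f i \<in> coset i ` lcs i) \<and> finite {i. f i \<noteq> coset i 0}}"

definition gr_component :: "nat \<Rightarrow> (nat \<Rightarrow> 'a set) set" where
  "gr_component d = {f \<in> gr_carrier. \<forall>i. i \<noteq> d \<longrightarrow> f i = coset i 0}"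

definition gr_add :: "(nat \<Rightarrow> 'a set) \<Rightarrow> (nat \<Rightarrow> 'a set) \<Rightarrow> nat \<Rightarrow> 'a set" where
  "gr_add f g i = {x + y |x y. x \<in> f i \<and> y \<in> g i}"

text \<open>The summand \<open>u\<close> matters for \<open>c = 0\<close>.\<close>

definition gr_scale :: "complex \<Rightarrow> (nat \<Rightarrow> 'a set) \<Rightarrow> nat \<Rightarrow> 'a set" where
  "gr_scale c f i = {scale c x + u |x u. x \<in> f i \<and> u \<in> lcs (Suc i)}"

text \<open>The component of degree \<open>k\<close> of a product is the sum of the induced brackets
  \<open>[f i, g j]\<close> over \<open>i, j \<ge> 1\<close> with \<open>i + j = k\<close>; \<open>a\<close> and \<open>b\<close> choose representatives.\<close>

definition gr_bracket :: "(nat \<Rightarrow> 'a set) \<Rightarrow> (nat \<Rightarrow> 'a set) \<Rightarrow> nat \<Rightarrow> 'a set" where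
  "gr_bracket f g k =
    {(\<Sum>i\<in>{1..<k}. bracket (a i) (b (k - i))) + u |a b u.
       (\<forall>i. a i \<in> f i) \<and> (\<forall>i. b i \<in> g i) \<and> u \<in> lcs (Suc k)}"

definition gr_iso :: "('a \<Rightarrow> nat \<Rightarrow> 'a set) \<Rightarrow> bool" where
  "gr_iso \<phi> \<longleftrightarrow>
    bij_betw \<phi> UNIV gr_carrier \<and>
    (\<forall>x y. \<phi> (x + y) = gr_add (\<phi> x) (\<phi> y)) \<and>
    (\<forall>c x. \<phi> (scale c x) = gr_scale c (\<phi> x)) \<and>
    (\<forall>x y. \<phi> (bracket x y) = gr_bracket (\<phi> x) (\<phi> y))"

definition naturally_graded :: bool where
  "naturally_graded \<longleftrightarrow> (\<exists>\<phi>. gr_iso \<phi>)"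

text \<open>\<open>e 1, \<dots>, e n\<close> is an adapted basis of type \<open>\<mu>\<^bsub>(I, r1, r2)\<^esub>\<close>, where \<open>\<L>\<close> is identified with
  its associated graded algebra along \<open>\<phi>\<close>.\<close>

definition adapted_basis_I ::
  "('a \<Rightarrow> nat \<Rightarrow> 'a set) \<Rightarrow> (nat \<Rightarrow> 'a) \<Rightarrow> nat \<Rightarrow> nat \<Rightarrow> bool" where
  "adapted_basis_I \<phi> e r1 r2 \<longleftrightarrow>
    (let n = dim (UNIV :: 'a set) in
      ordered_basis e {1..n} \<and>
      (\<forall>i\<in>{1..n}. \<exists>d. \<phi> (e i) \<in> gr_component d) \<and>
      \<phi> (e 1) \<in> gr_component 1 \<and>
      jordan_sizes (right_mult (e 1)) [n - 2, 1, 1] \<and>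
      (\<forall>i. 1 \<le> i \<and> i + 3 \<le> n \<longrightarrow> bracket (e i) (e 1) = e (i + 1)) \<and>
      bracket (e (n - 2)) (e 1) = 0 \<and>
      bracket (e (n - 1)) (e 1) = 0 \<and>
      bracket (e n) (e 1) = 0 \<and>
      \<phi> (e (n - 1)) \<in> gr_component r1 \<and>
      \<phi> (e n) \<in> gr_component r2)"

definition type_mu_I :: "nat \<Rightarrow> nat \<Rightarrow> bool" where
  "type_mu_I r1 r2 \<longleftrightarrow>
    naturally_graded \<and> two_filiform \<and> r1 \<le> r2 \<and>
    (\<exists>\<phi> e. gr_iso \<phi> \<and> adapted_basis_I \<phi> e r1 r2)"

end

definition isomorphic_algebras ::
  "(complex \<Rightarrow> 'a::ab_group_add \<Rightarrow> 'a) \<Rightarrow> ('a \<Rightarrow> 'a \<Rightarrow> 'a) \<Rightarrow>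
   (complex \<Rightarrow> 'b::ab_group_add \<Rightarrow> 'b) \<Rightarrow> ('b \<Rightarrow> 'b \<Rightarrow> 'b) \<Rightarrow> bool" where
  "isomorphic_algebras s1 b1 s2 b2 \<longleftrightarrow>
    (\<exists>f. Vector_Spaces.linear s1 s2 f \<and> bij f \<and> (\<forall>x y. f (b1 x y) = b2 (f x) (f y)))"

type_synonym complex4 = "complex \<times> complex \<times> complex \<times> complex"

definition scale4 :: "complex \<Rightarrow> complex4 \<Rightarrow> complex4" where
  "scale4 c = (\<lambda>(x1, x2, x3, x4). (c * x1, c * x2, c * x3, c * x4))"

text \<open>The bilinear extension of \<open>[e\<^sub>1, e\<^sub>1] = e\<^sub>2\<close>, \<open>[e\<^sub>1, e\<^sub>3] = e\<^sub>4\<close>, all other products of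
  standard basis vectors being zero.\<close>

definition bracket4 :: "complex4 \<Rightarrow> complex4 \<Rightarrow> complex4" where
  "bracket4 = (\<lambda>(x1, x2, x3, x4) (y1, y2, y3, y4). (0, x1 * y1, 0, x1 * y3))"

lemma bracket4_basis:
  fixes e :: "nat \<Rightarrow> complex4"
  defines "e \<equiv> (\<lambda>i. (of_bool (i = 1), of_bool (i = 2), of_bool (i = 3), of_bool (i = 4)))"
  assumes "i \<in> {1..4}" "j \<in> {1..4}"
  shows "bracket4 (e i) (e j) =
    (if (i, j) = (1, 1) then e 2 else if (i, j) = (1, 3) then e 4 else 0)"
  by (auto simp: e_def bracket4_def zero_prod_def)

lemma leibniz_algebra_bracket4: "leibniz_algebra scale4 bracket4"
proof -
  interpret V: vector_space scale4
    by unfold_locales (auto simp: scale4_def algebra_simps split: prod.splits)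
  define B :: "complex4 set" where "B = {(1,0,0,0), (0,1,0,0), (0,0,1,0), (0,0,0,1)}"
  have "x \<in> V.span B" for x
  proof -
    obtain a b c d where x: "x = (a, b, c, d)" by (cases x)
    have "x = scale4 a (1,0,0,0) + (scale4 b (0,1,0,0) + (scale4 c (0,0,1,0) + scale4 d (0,0,0,1)))"
      by (simp add: x scale4_def)
    moreover have "\<dots> \<in> V.span B"
      by (intro V.span_add V.span_scale V.span_base) (simp_all add: B_def)
    ultimately show ?thesis
      by (simp only:)
  qed
  then have "finite B \<and> V.span B = UNIV"
    by (auto simp: B_def)
  then show ?thesis
    by unfold_locales
      (auto simp: scale4_def bracket4_def algebra_simps split: prod.splits)
qed

end

theory Submission
  imports Defs
begin

text \<open>The gradation kills all products except \<open>\<L>\<^sub>1 \<times> \<L>\<^sub>1 \<rightarrow> \<L>\<^sub>2\<close>, where \<open>\<L>\<^sub>1\<close> is spanned by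
  \<open>e\<^sub>1, e\<^sub>3\<close> and \<open>\<L>\<^sub>2\<close> by \<open>e\<^sub>2, e\<^sub>4\<close>. Hence \<open>[e\<^sub>1, e\<^sub>3] = \<alpha> e\<^sub>2 + \<beta> e\<^sub>4\<close> and
  \<open>[e\<^sub>3, e\<^sub>3] = \<gamma> e\<^sub>2 + \<delta> e\<^sub>4\<close> are the only unknown products. Right multiplication by
  \<open>a e\<^sub>1 + e\<^sub>3\<close> has square zero, so if it had rank 2 its Jordan blocks would have sizes \<open>(2, 2)\<close>,
  exceeding \<open>(2, 1, 1)\<close>. The vanishing of the corresponding determinant
  \<open>a \<delta> + \<alpha> \<delta> - \<beta> \<gamma>\<close> for \<open>a = 0, 1\<close> gives \<open>\<delta> = 0\<close> and \<open>\<beta> \<gamma> = 0\<close>. If \<open>\<beta> = 0\<close>, the line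
  through \<open>e\<^sub>4\<close> is a direct summand; so \<open>\<gamma> = 0\<close>, and \<open>[e\<^sub>1, e\<^sub>3]\<close> replaces \<open>e\<^sub>4\<close> in the basis.\<close>

section \<open>Two computations in explicit coordinates\<close>

lemma bij_block4:
  fixes A B C D :: complex
  assumes "A * D \<noteq> B * C"
  shows "bij (\<lambda>(x1, x2, x3, x4). (x1 :: complex, A * x2 + C * x4, x3 :: complex, B * x2 + D * x4))"
    (is "bij ?h")
proof -
  define t where "t = A * D - B * C"
  have t: "t \<noteq> 0"
    using assms by (simp add: t_def)
  \<comment> \<open>Cramer's rule for the 2 by 2 block acting on the second and fourth coordinates,
    whose determinant is \<open>t\<close>.\<close>
  define k where "k = (\<lambda>(x1 :: complex, x2, x3 :: complex, x4).
    (x1, (D * x2 - C * x4) / t, x3, (A * x4 - B * x2) / t))"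
  have "k (?h x) = x" for x
  proof -
    obtain x1 x2 x3 x4 where x: "x = (x1, x2, x3, x4)" by (cases x)
    have "D * (A * x2 + C * x4) - C * (B * x2 + D * x4) = x2 * t"
      "A * (B * x2 + D * x4) - B * (A * x2 + C * x4) = x4 * t"
      by (simp_all add: t_def algebra_simps)
    then show ?thesis using t by (simp add: k_def x)
  qed
  moreover have "?h (k x) = x" for x
  proof -
    obtain x1 x2 x3 x4 where x: "x = (x1, x2, x3, x4)" by (cases x)
    have "A * (D * x2 - C * x4) + C * (A * x4 - B * x2) = x2 * t"
      "B * (D * x2 - C * x4) + D * (A * x4 - B * x2) = x4 * t"
      by (simp_all add: t_def algebra_simps)
    then show ?thesis using t
      by (simp add: k_def x add_divide_distrib[symmetric])
  qed
  ultimately show ?thesis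
    by (intro o_bij[of k]) (auto simp: fun_eq_iff)
qed

text \<open>The entrywise form in which the matrix of an operator can be compared with two nilpotent
  blocks. The ones stand above the diagonal, so within a block the image of a vector precedes the
  vector.\<close>

lemma jordan_matrix_two_two:
  "jordan_matrix [(2, 0), (2, 0)] =
    mat 4 4 (\<lambda>(i, j). if (i, j) = (0, 1) \<or> (i, j) = (2, 3) then 1 else (0 :: complex))"
proof (rule eq_matI, goal_cases)
  case (1 i j)
  then have "i \<in> {0, 1, 2, 3}" "j \<in> {0, 1, 2, 3}" by auto
  then show ?case by (auto simp: jordan_matrix_def jordan_block_def Let_def)
qed (simp_all add: jordan_matrix_def Let_def)

context leibniz_algebra
begin

section \<open>Bilinearity and the lower central series\<close>

lemma bracket_add_left: "bracket (x + y) z = bracket x z + bracket y z"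
  and bracket_scale_left: "bracket (scale c x) z = scale c (bracket x z)"
  using linear_left[of z] by (simp_all add: Vector_Spaces.linear_iff)

lemma bracket_add_right: "bracket x (y + z) = bracket x y + bracket x z"
  and bracket_scale_right: "bracket x (scale c y) = scale c (bracket x y)"
  using linear_right[of x] by (simp_all add: Vector_Spaces.linear_iff)

lemma bracket_zero_right [simp]: "bracket x 0 = 0"
  using bracket_scale_right[of x 0 0] by simp

lemma subspace_lcs: "subspace (lcs k)"
  by (cases k rule: lcs.cases) auto

lemma bracket_lcs_UNIV: "1 \<le> i \<Longrightarrow> x \<in> lcs i \<Longrightarrow> bracket x y \<in> lcs (Suc i)"
  by (cases i) (auto intro: span_base)

text \<open>Induction on \<open>j\<close>. On a generator \<open>bracket u v\<close> of the next
  term, the Leibniz identity leaves \<open>bracket (bracket x u) v\<close> and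
  \<open>bracket (bracket x v) u\<close>. The second needs the induction hypothesis at
  \<open>Suc i\<close>, so \<open>i\<close> is kept arbitrary.\<close>

lemma bracket_lcs:
  assumes "1 \<le> i" "1 \<le> j" "x \<in> lcs i" "y \<in> lcs j"
  shows "bracket x y \<in> lcs (i + j)"
  using assms(2,1,3,4)
proof (induction j arbitrary: i x y rule: dec_induct)
  case base
  then show ?case using bracket_lcs_UNIV by simp
next
  case (step j)
  note IH = step.IH and i = \<open>1 \<le> i\<close> and x = \<open>x \<in> lcs i\<close>
  from step obtain j' where j': "j = Suc j'" by (cases j) auto
  have "y \<in> span {bracket u v |u v. u \<in> lcs j}"
    using step.prems j' by simp
  then show ?case
  proof (induction rule: span_induct_alt)
    case base
    then show ?case using subspace_lcs subspace_0 by simp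
  next
    case (step c w z)
    then obtain u v where w: "w = bracket u v" and u: "u \<in> lcs j" by blast
    have "bracket (bracket x u) v \<in> lcs (Suc (i + j))"
      using i by (intro bracket_lcs_UNIV IH x u) auto
    moreover have "bracket (bracket x v) u \<in> lcs (Suc i + j)"
      using i by (intro bracket_lcs_UNIV IH x u) auto
    ultimately have "bracket x w \<in> lcs (i + Suc j)"
      using subspace_lcs by (simp add: w leibniz subspace_diff)
    then show ?case
      using step subspace_lcs
      by (simp add: bracket_add_right bracket_scale_right subspace_add subspace_scale)
  qed
qed

section \<open>Homogeneous parts of the gradation\<close>

lemma coset_zero: "coset i 0 = lcs (Suc i)"
  by (simp add: coset_def)

text \<open>Cosets of a subspace are equal or disjoint. Hence a single inclusion is enough to show
  that an entry of a graded element vanishes.\<close>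

lemma coset_subset_lcs_eq:
  assumes "coset i x \<subseteq> lcs (Suc i)"
  shows "coset i x = lcs (Suc i)"
proof -
  have "x + 0 \<in> coset i x"
    unfolding coset_def using subspace_lcs subspace_0 by blast
  then have x: "x \<in> lcs (Suc i)" using assms by auto
  have "u \<in> coset i x" if "u \<in> lcs (Suc i)" for u
  proof -
    have "u = x + (u - x)" by simp
    then show ?thesis
      unfolding coset_def using x that subspace_diff[OF subspace_lcs] by blast
  qed
  then show ?thesis using assms by auto
qed

text \<open>The homogeneous component pulled back along \<phi>, so that degrees can be discussed for
  elements of the algebra instead of families of cosets.\<close>

definition graded_part :: "('a \<Rightarrow> nat \<Rightarrow> 'a set) \<Rightarrow> nat \<Rightarrow> 'a set" where
  "graded_part \<phi> d = {x. \<phi> x \<in> gr_component d}"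

lemma graded_partI:
  assumes "gr_iso \<phi>" "\<And>i. i \<noteq> d \<Longrightarrow> \<phi> x i \<subseteq> lcs (Suc i)"
  shows "x \<in> graded_part \<phi> d"
proof -
  have \<phi>: "\<phi> x \<in> gr_carrier"
    using assms(1) by (auto simp: gr_iso_def bij_betw_def)
  have "\<phi> x i = lcs (Suc i)" if "i \<noteq> d" for i
  proof -
    have "\<phi> x i \<in> coset i ` lcs i" using \<phi> by (auto simp: gr_carrier_def)
    then show ?thesis using coset_subset_lcs_eq assms(2)[OF that] by blast
  qed
  then show ?thesis
    using \<phi> by (simp add: graded_part_def gr_component_def coset_zero)
qed

lemma graded_partD:
  "x \<in> graded_part \<phi> d \<Longrightarrow> i \<noteq> d \<Longrightarrow> \<phi> x i = lcs (Suc i)"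
  by (simp add: graded_part_def gr_component_def coset_zero)

lemma subspace_graded_part:
  assumes "gr_iso \<phi>"
  shows "subspace (graded_part \<phi> d)"
proof -
  have add: "\<phi> (x + y) = gr_add (\<phi> x) (\<phi> y)" and sc: "\<phi> (scale c x) = gr_scale c (\<phi> x)" for x y c
    using assms by (auto simp: gr_iso_def)
  have scale: "scale c x \<in> graded_part \<phi> d" if "x \<in> graded_part \<phi> d" for c x
    using graded_partD[OF that] subspace_lcs
    by (intro graded_partI assms) (auto simp: sc gr_scale_def subspace_add subspace_scale)
  have "0 \<in> graded_part \<phi> d"
  proof -
    \<comment> \<open>Written as \<open>scale 0 0\<close>, the zero vector has entries consisting of
      elements \<open>0 + u\<close> with \<open>u\<close> in \<open>lcs (Suc i)\<close>, whatever
      \<phi> does to 0.\<close>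
    have "\<phi> (scale 0 0) i \<subseteq> lcs (Suc i)" for i
      unfolding sc gr_scale_def by auto
    then show ?thesis by (intro graded_partI assms) simp
  qed
  moreover have "x + y \<in> graded_part \<phi> d" if "x \<in> graded_part \<phi> d" "y \<in> graded_part \<phi> d" for x y
    using graded_partD[OF that(1)] graded_partD[OF that(2)] subspace_lcs
    by (intro graded_partI assms) (auto simp: add gr_add_def subspace_add)
  ultimately show ?thesis
    using scale by (auto simp: subspace_def)
qed

text \<open>Each entry is the zero coset by one of the two memberships. So \<open>x\<close> and 0
  have the same image, and \<phi> is injective.\<close>

lemma graded_part_disjoint:
  assumes "gr_iso \<phi>" "d \<noteq> d'" "x \<in> graded_part \<phi> d" "x \<in> graded_part \<phi> d'"
  shows "x = 0"
proof -
  have "\<phi> x i = lcs (Suc i)" for i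
    using assms(2) graded_partD[OF assms(3)] graded_partD[OF assms(4)] by (cases "i = d") auto
  moreover have "\<phi> 0 i = lcs (Suc i)" for i
    using graded_partD[of 0 \<phi> i] graded_partD[of 0 \<phi> "Suc i" i]
      subspace_0[OF subspace_graded_part[OF assms(1)]] by simp
  ultimately have "\<phi> x = \<phi> 0" by (simp add: fun_eq_iff)
  then show ?thesis
    using assms(1) by (auto simp: gr_iso_def bij_betw_def dest: injD)
qed

text \<open>The entry of degree \<open>d\<close> vanishes because neither summand has degree
  \<open>d\<close>, and all other entries vanish because the sum has degree \<open>d\<close>. The
  sum then also lies in the part of another degree, for which \<open>Suc d\<close> is taken.\<close>

lemma graded_part_sum_disjoint:
  assumes "gr_iso \<phi>" "d \<noteq> d1" "d \<noteq> d2"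
    and "x \<in> graded_part \<phi> d1" "y \<in> graded_part \<phi> d2" "x + y \<in> graded_part \<phi> d"
  shows "x + y = 0"
proof -
  have "\<phi> (x + y) d = gr_add (\<phi> x) (\<phi> y) d"
    using assms(1) by (simp add: gr_iso_def)
  also have "\<dots> \<subseteq> lcs (Suc d)"
    using graded_partD[OF assms(4,2)] graded_partD[OF assms(5,3)] subspace_lcs
    by (auto simp: gr_add_def subspace_add)
  finally have "\<phi> (x + y) i \<subseteq> lcs (Suc i)" for i
    using graded_partD[OF assms(6), of i] by (cases "i = d") auto
  then have "x + y \<in> graded_part \<phi> (Suc d)"
    by (intro graded_partI assms(1))
  then show ?thesis
    using graded_part_disjoint[OF assms(1) _ assms(6)] by (metis n_not_Suc_n)
qed

text \<open>The series is decreasing, so a coset of \<open>lcs (Suc i)\<close> through a point of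
  \<open>lcs i\<close> stays inside \<open>lcs i\<close>.\<close>

lemma gr_carrier_subset_lcs:
  assumes "f \<in> gr_carrier"
  shows "f i \<subseteq> lcs i"
proof -
  have "lcs (Suc i) \<subseteq> lcs i" for i
  proof (induction i)
    case (Suc i)
    show ?case
    proof (cases i)
      case (Suc k)
      then show ?thesis using Suc.IH by (auto intro!: span_mono)
    qed simp
  qed simp
  moreover obtain x where "f i = coset i x" "x \<in> lcs i"
    using assms by (auto simp: gr_carrier_def)
  ultimately show ?thesis
    using subspace_lcs by (fastforce simp: coset_def subspace_add)
qed

text \<open>If \<open>k\<close> differs from \<open>p + q\<close>, then in every summand of the
  entry of degree \<open>k\<close> either \<open>i\<close> differs from \<open>p\<close> or
  \<open>k - i\<close> differs from \<open>q\<close>. The corresponding factor lies one step deeper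
  in the series, and \<open>bracket_lcs\<close> puts the product into
  \<open>lcs (Suc k)\<close>.\<close>

lemma bracket_graded_part:
  assumes iso: "gr_iso \<phi>" and x: "x \<in> graded_part \<phi> p" and y: "y \<in> graded_part \<phi> q"
  shows "bracket x y \<in> graded_part \<phi> (p + q)"
proof (rule graded_partI[OF iso])
  fix k assume k: "k \<noteq> p + q"
  have carrier: "\<phi> z i \<subseteq> lcs i" for z i
    using iso by (intro gr_carrier_subset_lcs) (auto simp: gr_iso_def bij_betw_def)
  have "(\<Sum>i\<in>{1..<k}. bracket (a i) (b (k - i))) + u \<in> lcs (Suc k)"
    if a: "\<And>i. a i \<in> \<phi> x i" and b: "\<And>i. b i \<in> \<phi> y i" and u: "u \<in> lcs (Suc k)" for a b u
  proof -
    have "bracket (a i) (b (k - i)) \<in> lcs (Suc k)" if i: "i \<in> {1..<k}" for i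
    proof (cases "i = p")
      case True
      then have "k - i \<noteq> q" using k i by auto
      then have "b (k - i) \<in> lcs (Suc (k - i))" using graded_partD[OF y] b by blast
      moreover have "a i \<in> lcs i" using a carrier by blast
      ultimately show ?thesis using bracket_lcs[of i "Suc (k - i)"] i by simp
    next
      case False
      then have "a i \<in> lcs (Suc i)" using graded_partD[OF x] a by blast
      moreover have "b (k - i) \<in> lcs (k - i)" using b carrier by blast
      ultimately show ?thesis using bracket_lcs[of "Suc i" "k - i"] i by (simp add: Suc_le_eq)
    qed
    then show ?thesis
      using u subspace_lcs by (intro subspace_add subspace_sum) auto
  qed
  moreover have "\<phi> (bracket x y) = gr_bracket (\<phi> x) (\<phi> y)"
    using iso by (simp add: gr_iso_def)
  ultimately show "\<phi> (bracket x y) k \<subseteq> lcs (Suc k)"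
    by (auto simp: gr_bracket_def)
qed

section \<open>Bases, coordinates and Jordan chains in dimension four\<close>

lemma ordered_basis_iff:
  assumes N: "finite N"
  shows "ordered_basis b N \<longleftrightarrow>
    (\<forall>c. (\<Sum>i\<in>N. scale (c i) (b i)) = 0 \<longrightarrow> (\<forall>i\<in>N. c i = 0)) \<and>
    (\<forall>x. \<exists>c. x = (\<Sum>i\<in>N. scale (c i) (b i)))"
    (is "_ \<longleftrightarrow> ?indep \<and> ?span")
proof
  assume ob: "ordered_basis b N"
  then have inj: "inj_on b N" and ind: "independent (b ` N)" and sp: "span (b ` N) = UNIV"
    by (auto simp: ordered_basis_def)
  have ?indep
  proof (intro allI impI ballI)
    fix c i assume c: "(\<Sum>i\<in>N. scale (c i) (b i)) = 0" and i: "i \<in> N"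
    have "(\<Sum>v\<in>b ` N. scale (c (the_inv_into N b v)) v) = 0"
      using c inj by (simp add: sum.reindex the_inv_into_f_f)
    then have "c (the_inv_into N b (b i)) = 0"
      using ind N i by (auto simp: dependent_finite)
    then show "c i = 0" using inj i by (simp add: the_inv_into_f_f)
  qed
  moreover have ?span
  proof
    fix x
    have "x \<in> span (b ` N)" using sp by simp
    then obtain u where "x = (\<Sum>v\<in>b ` N. scale (u v) v)"
      using N by (auto simp: span_finite)
    then have "x = (\<Sum>i\<in>N. scale (u (b i)) (b i))"
      using inj by (simp add: sum.reindex)
    then show "\<exists>c. x = (\<Sum>i\<in>N. scale (c i) (b i))" by (intro exI[of _ "\<lambda>i. u (b i)"])
  qed
  ultimately show "?indep \<and> ?span" by simp
next
  assume coord: "?indep \<and> ?span"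
  have inj: "inj_on b N"
  proof (rule inj_onI, rule ccontr)
    fix i j assume ij: "i \<in> N" "j \<in> N" "b i = b j" "i \<noteq> j"
    \<comment> \<open>A repeated vector gives the nontrivial relation with coefficients 1 and
      -1.\<close>
    define c :: "nat \<Rightarrow> complex" where "c = (\<lambda>k. if k = i then 1 else if k = j then - 1 else 0)"
    have "(\<Sum>k\<in>N. scale (c k) (b k)) = (\<Sum>k\<in>{i, j}. scale (c k) (b k))"
      using N ij by (intro sum.mono_neutral_right) (auto simp: c_def)
    also have "\<dots> = 0" using ij by (simp add: c_def)
    finally have "c i = 0" using coord ij by blast
    then show False by (simp add: c_def)
  qed
  have "independent (b ` N)"
    using coord inj N by (auto simp: dependent_finite sum.reindex)
  moreover have "x \<in> span (b ` N)" for x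
  proof -
    obtain c where "x = (\<Sum>i\<in>N. scale (c i) (b i))" using coord by blast
    then show ?thesis by (auto intro: span_sum span_scale span_base)
  qed
  ultimately show "ordered_basis b N"
    using inj by (auto simp: ordered_basis_def)
qed

text \<open>The coordinate map of four vectors. That they form a basis is expressed as bijectivity
  of this map, so that a change of basis becomes a composition of maps.\<close>

definition comb4 :: "'a \<Rightarrow> 'a \<Rightarrow> 'a \<Rightarrow> 'a \<Rightarrow> complex4 \<Rightarrow> 'a" where
  "comb4 p q r s = (\<lambda>(x1, x2, x3, x4). scale x1 p + scale x2 q + scale x3 r + scale x4 s)"

lemma comb4_diff: "comb4 p q r s x - comb4 p q r s y = comb4 p q r s (x - y)"
  by (cases x, cases y) (simp add: comb4_def scale_left_diff_distrib)

lemma bij_comb4_iff: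
  "bij (comb4 p q r s) \<longleftrightarrow>
    (\<forall>x. comb4 p q r s x = 0 \<longrightarrow> x = 0) \<and> (\<forall>y. \<exists>x. y = comb4 p q r s x)"
proof -
  have "comb4 p q r s 0 = 0" by (simp add: comb4_def zero_prod_def)
  then have "inj (comb4 p q r s) \<longleftrightarrow> (\<forall>x. comb4 p q r s x = 0 \<longrightarrow> x = 0)"
    unfolding inj_def by (metis comb4_diff eq_iff_diff_eq_0)
  then show ?thesis by (auto simp: bij_def surj_def)
qed

lemma bij_comb4_ordered_basis:
  assumes "ordered_basis e {1..4}"
  shows "bij (comb4 (e 1) (e 2) (e 3) (e 4))"
proof -
  have N: "{1..4} = {1, 2, 3, 4 :: nat}" by auto
  have sum: "(\<Sum>i\<in>{1..4}. scale (c i) (e i)) = comb4 (e 1) (e 2) (e 3) (e 4) (c 1, c 2, c 3, c 4)"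
    for c by (simp only: N) (simp add: comb4_def add.assoc)
  show ?thesis
    unfolding bij_comb4_iff
  proof (intro conjI allI impI)
    fix x assume x: "comb4 (e 1) (e 2) (e 3) (e 4) x = 0"
    obtain x1 x2 x3 x4 where x': "x = (x1, x2, x3, x4)" by (cases x)
    define c where "c = (\<lambda>i::nat. if i = 1 then x1 else if i = 2 then x2 else if i = 3 then x3 else x4)"
    have "(\<Sum>i\<in>{1..4}. scale (c i) (e i)) = 0"
      unfolding sum using x x' by (simp add: c_def)
    then have "c 1 = 0 \<and> c 2 = 0 \<and> c 3 = 0 \<and> c 4 = 0"
      using assms by (simp add: ordered_basis_iff N)
    then show "x = 0" by (simp add: c_def x' zero_prod_def)
  next
    fix y show "\<exists>x. y = comb4 (e 1) (e 2) (e 3) (e 4) x"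
      using assms sum ordered_basis_iff[of "{1..4}" e] by (metis finite_atLeastAtMost)
  qed
qed

text \<open>The order \<open>q, p, s, r\<close> anticipates the case where \<open>q\<close> and
  \<open>s\<close> are the images of \<open>p\<close> and \<open>r\<close> under an operator: each
  Jordan chain then begins with the image.\<close>

lemma ordered_basis_comb4:
  assumes "bij (comb4 p q r s)"
  shows "ordered_basis ((!) [q, p, s, r]) {..<4}"
proof -
  have N: "{..<4} = {0, 1, 2, 3 :: nat}" by auto
  have sum: "(\<Sum>i<4. scale (c i) ([q, p, s, r] ! i)) = comb4 p q r s (c 1, c 0, c 3, c 2)" for c
    by (simp add: N comb4_def algebra_simps eval_nat_numeral)
  show ?thesis
    unfolding ordered_basis_iff[OF finite_lessThan] sum
  proof (intro conjI allI impI)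
    fix c :: "nat \<Rightarrow> complex" assume "comb4 p q r s (c 1, c 0, c 3, c 2) = 0"
    then have "(c 1, c 0, c 3, c 2) = (0 :: complex4)"
      using assms bij_comb4_iff by blast
    then show "\<forall>i\<in>{..<4::nat}. c i = 0" by (simp add: N zero_prod_def)
  next
    fix y
    obtain x where x: "y = comb4 p q r s x" using assms bij_comb4_iff by blast
    obtain x1 x2 x3 x4 where x': "x = (x1, x2, x3, x4)" by (cases x)
    show "\<exists>c. y = comb4 p q r s (c 1, c 0, c 3, c (2 :: nat))"
      by (intro exI[of _ "(!) [x2, x1, x4, x3]"]) (simp add: x x' eval_nat_numeral)
  qed
qed

text \<open>The new coordinate map is the old one precomposed with the block map of
  \<open>bij_block4\<close>.\<close>

lemma bij_comb4_change:
  assumes "bij (comb4 p q r s)" "A * D \<noteq> B * C"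
  shows "bij (comb4 p (scale A q + scale B s) r (scale C q + scale D s))"
proof -
  have "comb4 p (scale A q + scale B s) r (scale C q + scale D s) =
      comb4 p q r s \<circ> (\<lambda>(x1, x2, x3, x4). (x1, A * x2 + C * x4, x3, B * x2 + D * x4))"
    by (simp add: fun_eq_iff comb4_def algebra_simps)
  then show ?thesis
    using assms bij_block4 by (simp add: bij_comp)
qed

text \<open>\<open>T p, p\<close> and \<open>T r, r\<close> are two Jordan chains of length 2 for
  the eigenvalue 0. In this basis the matrix of \<open>T\<close> is already in Jordan form.\<close>

lemma jordan_sizes_two_two:
  assumes dim: "dim (UNIV :: 'a set) = 4" and bij: "bij (comb4 p (T p) r (T r))"
    and T: "T (T p) = 0" "T (T r) = 0"
  shows "jordan_sizes T [2, 2]"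
proof -
  define b where "b = (!) [T p, p, T r, r]"
  have ob: "ordered_basis b {..<4}"
    unfolding b_def by (rule ordered_basis_comb4[OF bij])
  have inj: "inj_on b {..<4}" and ind: "independent (b ` {..<4})"
    using ob by (auto simp: ordered_basis_def)
  have rep: "representation (b ` {..<4}) (b j) (b i) = of_bool (i = j)" if "i < 4" "j < 4" for i j
    using that inj ind representation_basis[of "b ` {..<4}" "b j"]
    by (auto dest: inj_onD)
  have Tb: "T (b 0) = 0" "T (b 1) = b 0" "T (b 2) = 0" "T (b 3) = b 2"
    using T by (simp_all add: b_def eval_nat_numeral)
  have "representation (b ` {..<4}) (T (b j)) (b i) =
      (if (i, j) = (0, 1) \<or> (i, j) = (2, 3) then 1 else 0)" if "i < 4" "j < 4" for i j
  proof -
    have "j = 0 \<or> j = 1 \<or> j = 2 \<or> j = 3" using that by auto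
    then show ?thesis
      using that Tb rep[of i 0] rep[of i 2] by (auto simp: representation_zero)
  qed
  then have "matrix_of b T = jordan_matrix [(2, 0), (2, 0)]"
    unfolding jordan_matrix_two_two by (intro eq_matI) (auto simp: matrix_of_def dim)
  then have "jordan_nf (matrix_of b T) [(2, 0), (2, 0)]"
    by (simp add: jordan_nf_def similar_mat_refl[OF jordan_matrix_carrier])
  then show ?thesis
    unfolding jordan_sizes_def dim using ob
    by (intro exI[of _ b] exI[of _ "[(2, 0), (2, 0)]"]) simp
qed

section \<open>Structure constants of an algebra of the given type, and their reduction to normal
  form\<close>

lemma type_mu_I_isomorphic:
  assumes dim: "dim (UNIV :: 'a set) = 4"
    and filiform: "two_filiform" and non_split: "non_split" and type: "type_mu_I 1 2"
  shows "isomorphic_algebras scale bracket scale4 bracket4"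
proof -
  obtain \<phi> e where iso: "gr_iso \<phi>" and adapted: "adapted_basis_I \<phi> e 1 2"
    using type by (auto simp: type_mu_I_def)
  define p q r s where "p = e 1" and "q = e 2" and "r = e 3" and "s = e 4"
  note pqrs = p_def q_def r_def s_def
  \<comment> \<open>In dimension 4 the chain condition has \<open>i = 1\<close> as its only
    instance, and \<open>r\<close> is the vector of index \<open>n - 1\<close>.\<close>
  have pp: "bracket p p = q" and rp: "bracket r p = 0"
    using adapted by (auto simp: adapted_basis_I_def Let_def dim pqrs numeral_2_eq_2)
  have deg: "p \<in> graded_part \<phi> 1" "r \<in> graded_part \<phi> 1" "s \<in> graded_part \<phi> 2"
    using adapted by (auto simp: adapted_basis_I_def Let_def dim pqrs graded_part_def)
  \<comment> \<open>The adapted basis only makes \<open>q\<close> homogeneous; its degree comes from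
    \<open>q\<close> being the square of \<open>p\<close>.\<close>
  then have q: "q \<in> graded_part \<phi> 2"
    using bracket_graded_part[OF iso deg(1) deg(1)] pp by (simp add: numeral_2_eq_2)
  have "ordered_basis e {1..4}"
    using adapted by (simp add: adapted_basis_I_def Let_def dim)
  then have bij: "bij (comb4 p q r s)"
    unfolding pqrs by (rule bij_comb4_ordered_basis)
  note sub = subspace_add[OF subspace_graded_part[OF iso]]
    subspace_scale[OF subspace_graded_part[OF iso]]
  have coords: "\<exists>x1 x2 x3 x4. y = (scale x1 p + scale x3 r) + (scale x2 q + scale x4 s)" for y
  proof -
    obtain x where "y = comb4 p q r s x" using bij bij_comb4_iff by blast
    then show ?thesis
      by (cases x) (auto simp: comb4_def ac_simps intro!: exI)
  qed
  \<comment> \<open>After subtraction of the part along \<open>q\<close> and \<open>s\<close>, the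
    remainder \<open>z\<close> has degree 2 and also degree 1, hence is zero.\<close>
  have part2: "\<exists>x2 x4. y = scale x2 q + scale x4 s" if y: "y \<in> graded_part \<phi> 2" for y
  proof -
    obtain x1 x2 x3 x4 where y': "y = (scale x1 p + scale x3 r) + (scale x2 q + scale x4 s)"
      using coords by blast
    define z where "z = y - (scale x2 q + scale x4 s)"
    have "z \<in> graded_part \<phi> 2"
      unfolding z_def
      using y q deg by (intro subspace_diff[OF subspace_graded_part[OF iso]] sub)
    moreover have "z \<in> graded_part \<phi> 1"
      using deg y' sub by (simp add: z_def)
    ultimately have "z = 0"
      using graded_part_disjoint[OF iso, of 1 2] by simp
    then show ?thesis by (auto simp: z_def)
  qed
  \<comment> \<open>Every element is a sum of one of degree 1 and one of degree 2, so no nonzero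
    element has a higher degree.\<close>
  have part: "y = 0" if "y \<in> graded_part \<phi> d" "d > 2" for y d
  proof -
    obtain x1 x2 x3 x4 where y': "y = (scale x1 p + scale x3 r) + (scale x2 q + scale x4 s)"
      using coords by blast
    have "scale x1 p + scale x3 r \<in> graded_part \<phi> 1" "scale x2 q + scale x4 s \<in> graded_part \<phi> 2"
      using q deg by (auto intro!: sub)
    then show ?thesis
      using that graded_part_sum_disjoint[OF iso, of d 1 2] by (simp add: y')
  qed
  have zero: "bracket x y = 0"
    if "x \<in> graded_part \<phi> i" "y \<in> graded_part \<phi> j" "i + j > 2" for x y i j
    using bracket_graded_part[OF iso that(1,2)] part that(3) by blast
  note zeros = zero[OF deg(1) q] zero[OF deg(1) deg(3)] zero[OF deg(2) q] zero[OF deg(2) deg(3)]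
    zero[OF q deg(1)] zero[OF q deg(2)] zero[OF q q] zero[OF q deg(3)]
    zero[OF deg(3) deg(1)] zero[OF deg(3) deg(2)] zero[OF deg(3) q] zero[OF deg(3) deg(3)]
  have "bracket p r \<in> graded_part \<phi> 2" "bracket r r \<in> graded_part \<phi> 2"
    using bracket_graded_part[OF iso _ deg(2), of _ 1] deg by (simp_all add: numeral_2_eq_2)
  then obtain \<alpha> \<beta> \<gamma> \<delta> where pr: "bracket p r = scale \<alpha> q + scale \<beta> s"
    and rr: "bracket r r = scale \<gamma> q + scale \<delta> s"
    using part2 by meson
  note bilinear = bracket_add_left bracket_add_right bracket_scale_left bracket_scale_right
  have prod: "bracket (comb4 p q r s (x1, x2, x3, x4)) (comb4 p q r s (y1, y2, y3, y4)) =
      comb4 p q r s (0, x1 * y1 + x1 * y3 * \<alpha> + x3 * y3 * \<gamma>, 0, x1 * y3 * \<beta> + x3 * y3 * \<delta>)"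
    for x1 x2 x3 x4 y1 y2 y3 y4
    by (simp add: comb4_def bilinear zeros pp rp pr rr scale_right_distrib scale_left_distrib
        mult_ac add_ac)
  have ex: "\<exists>x1 x2 x3 x4. y = comb4 p q r s (x1, x2, x3, x4)" for y
    using bij unfolding bij_comb4_iff by (metis prod_cases4)
  \<comment> \<open>This serves to recognise nonzero elements of degree 1 as lying outside the
    derived algebra, where the characteristic sequence is taken.\<close>
  have lcs2: "lcs 2 \<subseteq> graded_part \<phi> 2"
  proof -
    have "bracket y z \<in> graded_part \<phi> 2" for y z
    proof -
      obtain x1 x2 x3 x4 where y: "y = comb4 p q r s (x1, x2, x3, x4)"
        using ex by blast
      obtain y1 y2 y3 y4 where z: "z = comb4 p q r s (y1, y2, y3, y4)"
        using ex by blast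
      show ?thesis
        unfolding y z prod using q deg by (simp add: comb4_def sub)
    qed
    then have "span {bracket x y |x y. x \<in> UNIV} \<subseteq> graded_part \<phi> 2"
      by (intro span_minimal subspace_graded_part iso) auto
    then show ?thesis by (simp add: numeral_2_eq_2)
  qed
  have det: "(a + \<alpha>) * \<delta> = \<beta> * \<gamma>" for a
  proof (rule ccontr)
    assume "(a + \<alpha>) * \<delta> \<noteq> \<beta> * \<gamma>"
    define x where "x = comb4 p q r s (a, 0, 1, 0)"
    define T where "T = right_mult x"
    have pe: "p = comb4 p q r s (1, 0, 0, 0)" and re: "r = comb4 p q r s (0, 0, 1, 0)"
      by (simp_all add: comb4_def)
    have Tp: "T p = comb4 p q r s (0, a + \<alpha>, 0, \<beta>)"
      unfolding T_def right_mult_def x_def by (subst pe, subst prod) simp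
    have Tr: "T r = comb4 p q r s (0, \<gamma>, 0, \<delta>)"
      unfolding T_def right_mult_def x_def by (subst re, subst prod) simp
    have "T (comb4 p q r s (0, c, 0, d)) = 0" for c d
      unfolding T_def right_mult_def x_def prod by (simp add: comb4_def)
    then have TT: "T (T p) = 0" "T (T r) = 0"
      by (simp_all add: Tp Tr)
    \<comment> \<open>In the coordinates along \<open>q\<close> and \<open>s\<close>, the vectors
      \<open>T p\<close> and \<open>T r\<close> have determinant
      \<open>(a + \<alpha>) * \<delta> - \<beta> * \<gamma>\<close>, nonzero by the assumption to be
      refuted.\<close>
    have "bij (comb4 p (T p) r (T r))"
      using bij_comb4_change[OF bij \<open>(a + \<alpha>) * \<delta> \<noteq> \<beta> * \<gamma>\<close>] by (simp add: Tp Tr comb4_def)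
    then have "jordan_sizes (right_mult x) [2, 2]"
      using jordan_sizes_two_two[OF dim, of p T r] TT T_def by simp
    moreover have "x \<notin> lcs 2"
    proof
      assume "x \<in> lcs 2"
      moreover have "x \<in> graded_part \<phi> 1"
        using deg by (simp add: x_def comb4_def sub)
      ultimately have "x = 0"
        using lcs2 graded_part_disjoint[OF iso, of 1 2] by auto
      then have "(a, 0, 1, 0) = (0 :: complex4)"
        using bij unfolding bij_comb4_iff x_def by blast
      then show False by (simp add: zero_prod_def)
    qed
    \<comment> \<open>The comparison fails at the second entry, where 2 meets 1.\<close>
    ultimately have "lexordp_eq [2, 2] [4 - 2, 1, 1 :: nat]"
      using filiform unfolding two_filiform_def characteristic_sequence_def dim by blast
    then show False by simp
  qed
  from det[of 0] det[of 1] have \<delta>: "\<delta> = 0"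
    by (simp add: algebra_simps)
  have \<beta>: "\<beta> \<noteq> 0"
  proof
    assume \<beta>: "\<beta> = 0"
    \<comment> \<open>\<open>I\<close> is spanned by \<open>p, q, r\<close> and \<open>J\<close> by
      \<open>s\<close>. With \<beta> and \<delta> both zero every product lies in \<open>I\<close>,
      and a product with a factor in \<open>J\<close> is zero, so both are ideals.\<close>
    define I where "I = comb4 p q r s ` {(x1, x2, x3, x4). x4 = 0}"
    define J where "J = comb4 p q r s ` {(x1, x2, x3, x4). x1 = 0 \<and> x2 = 0 \<and> x3 = 0}"
    have inj: "inj (comb4 p q r s)" using bij by (simp add: bij_def)
    have memI: "comb4 p q r s (x1, x2, x3, x4) \<in> I \<longleftrightarrow> x4 = 0"
      and memJ: "comb4 p q r s (x1, x2, x3, x4) \<in> J \<longleftrightarrow> x1 = 0 \<and> x2 = 0 \<and> x3 = 0"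
      for x1 x2 x3 x4
      by (simp_all add: I_def J_def inj_image_mem_iff[OF inj])
    have comb0: "0 = comb4 p q r s (0, 0, 0, 0)" by (simp add: comb4_def)
    have add: "comb4 p q r s (x1, x2, x3, x4) + comb4 p q r s (y1, y2, y3, y4) =
        comb4 p q r s (x1 + y1, x2 + y2, x3 + y3, x4 + y4)" for x1 x2 x3 x4 y1 y2 y3 y4
      by (simp add: comb4_def algebra_simps)
    have sc: "scale c (comb4 p q r s (x1, x2, x3, x4)) =
        comb4 p q r s (c * x1, c * x2, c * x3, c * x4)" for c x1 x2 x3 x4
      by (simp add: comb4_def algebra_simps)
    have zeroI: "0 \<in> I" and zeroJ: "0 \<in> J"
      by (simp_all add: comb0 memI memJ)
    have add_closed: "(x \<in> I \<and> y \<in> I \<longrightarrow> x + y \<in> I) \<and> (x \<in> J \<and> y \<in> J \<longrightarrow> x + y \<in> J)"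
      and bracket_closed: "bracket x y \<in> I \<and> (x \<in> J \<or> y \<in> J \<longrightarrow> bracket x y \<in> J)" for x y
    proof -
      obtain x1 x2 x3 x4 where x: "x = comb4 p q r s (x1, x2, x3, x4)" using ex by blast
      obtain y1 y2 y3 y4 where y: "y = comb4 p q r s (y1, y2, y3, y4)" using ex by blast
      show "(x \<in> I \<and> y \<in> I \<longrightarrow> x + y \<in> I) \<and> (x \<in> J \<and> y \<in> J \<longrightarrow> x + y \<in> J)"
        by (simp add: x y add memI memJ)
      show "bracket x y \<in> I \<and> (x \<in> J \<or> y \<in> J \<longrightarrow> bracket x y \<in> J)"
        by (auto simp: x y prod memI memJ \<beta> \<delta>)
    qed
    have "(x \<in> I \<longrightarrow> scale c x \<in> I) \<and> (x \<in> J \<longrightarrow> scale c x \<in> J) \<and> (x \<in> I \<inter> J \<longrightarrow> x = 0)"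
      for c x
    proof -
      obtain x1 x2 x3 x4 where x: "x = comb4 p q r s (x1, x2, x3, x4)" using ex by blast
      show ?thesis
        by (auto simp: x sc memI memJ comb0[symmetric])
    qed
    then have "ideal I" "ideal J" "I \<inter> J = {0}"
      using add_closed bracket_closed zeroI zeroJ by (auto simp: ideal_def subspace_def)
    \<comment> \<open>\<open>p\<close> lies in \<open>I\<close> but not in \<open>J\<close>, and
      \<open>s\<close> in \<open>J\<close> but not in \<open>I\<close>, while 0 lies in
      both.\<close>
    moreover have "I \<noteq> {0}" "J \<noteq> {0}"
      using memI[of 1 0 0 0] memJ[of 1 0 0 0] memI[of 0 0 0 1] memJ[of 0 0 0 1] zeroI zeroJ by auto
    moreover have "z \<in> {x + y |x y. x \<in> I \<and> y \<in> J}" for z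
    proof -
      obtain x1 x2 x3 x4 where "z = comb4 p q r s (x1, x2, x3, 0) + comb4 p q r s (0, 0, 0, x4)"
        using ex[of z] by (auto simp: add)
      then show ?thesis using memI memJ by blast
    qed
    then have "{x + y |x y. x \<in> I \<and> y \<in> J} = UNIV" by blast
    ultimately show False
      using non_split by (auto simp: non_split_def)
  qed
  then have \<gamma>: "\<gamma> = 0"
    using det[of 0] \<delta> by simp
  \<comment> \<open>The standard basis is sent to \<open>p\<close>, \<open>q\<close>,
    \<open>r\<close> and \<open>bracket p r\<close>. This is the inverse of the required
    isomorphism; the multiplication is easier to check in this direction.\<close>
  define g where "g = comb4 p q r (scale \<alpha> q + scale \<beta> s)"
  have g: "g (x1, x2, x3, x4) = comb4 p q r s (x1, x2 + \<alpha> * x4, x3, \<beta> * x4)" for x1 x2 x3 x4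
    by (simp add: g_def comb4_def algebra_simps)
  \<comment> \<open>The change from \<open>q, s\<close> to \<open>q, bracket p r\<close> has
    determinant \<beta>.\<close>
  have bij_g: "bij g"
    using bij_comb4_change[OF bij, of 1 \<beta> 0 \<alpha>] \<beta> by (simp add: g_def)
  have g_bracket: "g (bracket4 x y) = bracket (g x) (g y)" for x y
    by (cases x, cases y) (simp add: bracket4_def g prod \<gamma> \<delta> mult_ac)
  have g_add: "g (x + y) = g x + g y" and g_scale: "g (scale4 c x) = scale c (g x)" for c x y
    by (cases x, cases y, simp add: g_def comb4_def scale4_def algebra_simps)+
  interpret L4: leibniz_algebra scale4 bracket4
    by (rule leibniz_algebra_bracket4)
  define f where "f = inv_into UNIV g"
  have gf: "g (f x) = x" and fg: "f (g y) = y" for x y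
    using bij_g by (simp_all add: f_def bij_def surj_f_inv_f)
  \<comment> \<open>The inverse inherits linearity, as every argument can be written as
    \<open>g (f x)\<close>.\<close>
  have "Vector_Spaces.linear scale scale4 f"
    unfolding Vector_Spaces.linear_iff
    using vector_space_axioms L4.vector_space_axioms by (metis fg gf g_add g_scale)
  moreover have "bij f"
    using bij_g by (simp add: f_def bij_imp_bij_inv)
  moreover have "f (bracket x y) = bracket4 (f x) (f y)" for x y
    by (metis fg gf g_bracket)
  ultimately show ?thesis
    by (auto simp: isomorphic_algebras_def)
qed

end

theorem proposition2p3:
  fixes scale :: "complex \<Rightarrow> 'a::ab_group_add \<Rightarrow> 'a"
    and bracket :: "'a \<Rightarrow> 'a \<Rightarrow> 'a"
  assumes "leibniz_algebra scale bracket"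
    and "vector_space.dim scale (UNIV :: 'a set) = 4"
    and "leibniz_algebra.naturally_graded scale bracket"
    and "leibniz_algebra.two_filiform scale bracket"
    and "leibniz_algebra.non_split scale bracket"
    and "leibniz_algebra.type_mu_I scale bracket 1 2"
  shows "isomorphic_algebras scale bracket scale4 bracket4"
  using leibniz_algebra.type_mu_I_isomorphic[OF assms(1,2,4,5,6)] .

end
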